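(* Let $\lambda_0\ge0$, $\lambda_1\ge0$, let $\psi\in\Delta^N$ be any truncated stopping rule and $\chi$ any control policy. Then for any $1\le r\le N-1$ the following inequalities hold: $$L(\chi,\psi)\ge\sum_{n=1}^{r}\int s_n^{\psi,\chi}(nf_{\theta_0}^{n,\chi}+l_n^\chi)\,d\mu^n+\int c_{r+1}^{\psi,\chi}\left((r+1)f_{\theta_0}^{r+1,\chi}+V_{r+1}^{N,\chi}\right)d\mu^{r+1}$$ $$\ge\sum_{n=1}^{r-1}\int s_n^{\psi,\chi}(nf_{\theta_0}^{n,\chi}+l_n^\chi)\,d\mu^n+\int c_r^{\psi,\chi}\left(rf_{\theta_0}^{r,\chi}+V_r^{N,\chi}\right)d\mu^r,$$ where $V_N^N\equiv l_N$ and recursively for $k=N,N-1,\dots,2$ $$V_{k-1}^N=\min\{l_{k-1},f_{\theta_0}^{k-1}+R_{k-1}^N\},\qquad R_{k-1}^N(x^{(k-1)},y^{(k-1)})=\min_{x_k}\int V_k^N(x_1,\dots,x_k;y_1,\dots,y_k)\,d\mu(y_k).$$ The last lower bound is attained (i.e. $L(\chi,\psi)$ equals the last expression) if and only if, for every $k=r,\dots,N-1$, $$I_{\{l_k^\chi<f_{\theta_0}^{k,\chi}+R_k^{N,\chi}\}}\le\psi_k^\chi\le I_{\{l_k^\chi\le f_{\theta_0}^{k,\chi}+R_k^{N,\chi}\}}$$ $\mu^k$-almost everywhere on $C_k^{\psi,\chi}$, and $$R_k^{N,\chi}(y^{(k)})=\int V_{k+1}^{N,\chi}(y^{(k+1)})\,d\mu(y_{k+1})$$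 $\mu^k$-almost everywhere on $\bar C_k^{\psi,\chi}$.
   Context: Model. Controls $x$ take values in a measurable space; responses $y$ take values in a measurable space with a $\sigma$-finite measure $\mu$. For $\theta\in\{\theta_0,\theta_1\}$, $f_\theta(y|x)$ (measurable in $(x,y)$) is the density with respect to $\mu$ of the response when control $x$ is applied. Given controls, observations are independent; with $x^{(n)}=(x_1,\dots,x_n)$, $y^{(n)}=(y_1,\dots,y_n)$ put $f_\theta^n=f_\theta^n(x^{(n)},y^{(n)})=\prod_{i=1}^n f_\theta(y_i|x_i)$, a density with respect to the product measure $\mu^n=\mu\otimes\dots\otimes\mu$. A control policy is $\chi=(\chi_1,\chi_2,\dots)$ with $\chi_n=\chi_n(x^{(n-1)},y^{(n-1)})$ measurable, with values in the control space ($\chi_1$ is a constant). A stopping rule is $\psi=(\psi_1,\psi_2,\dots)$ with $\psi_n=\psi_n(x^{(n)},y^{(n)})\in[0,1]$ measurable, the conditional probability of stopping at stage $n$. $\Delta^N$ is the class of truncated stopping rules $\psi=(\psi_1,\dots,\psi_{N-1},1,\dots)$, i.e. with $\psi_N\equiv1$. For any function $F_n=F_n(x^{(n)},y^{(n)})$ let $F_n^\chi(y^{(n)})=F_n(x^{(n)},y^{(n)})$ with $x_i=\chi_i(x^{(i-1)},y^{(i-1)})$, $i=1,\dots,n$; in particular $f_\theta^{n,\chi}=(f_\theta^n)^\chi$, $V_k^{N,\chi}=(V_k^N)^\chi$, $R_k^{N,\chi}=(R_k^N)^\chi$. Let $s_n^{\psi,\chi}=(1-\psi_1^\chi)\cdots(1-\psi_{n-1}^\chi)\psi_n^\chi$,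 $c_n^{\psi,\chi}=(1-\psi_1^\chi)\cdots(1-\psi_{n-1}^\chi)$ (with $c_1^{\psi,\chi}=1$), $l_n=\min\{\lambda_0f_{\theta_0}^n,\lambda_1f_{\theta_1}^n\}$, and, for $\psi\in\Delta^N$, $$L(\chi,\psi)=\sum_{n=1}^\infty\int s_n^{\psi,\chi}\,(nf_{\theta_0}^{n,\chi}+l_n^\chi)\,d\mu^n .$$ Let $C_1^{\psi,\chi}$ be the whole space of $y^{(1)}$; for $n\ge2$, $C_n^{\psi,\chi}=\{y^{(n)}:(1-\psi_1^\chi(y^{(1)}))\cdots(1-\psi_{n-1}^\chi(y^{(n-1)}))>0\}$; for $n\ge1$, $\bar C_n^{\psi,\chi}=\{y^{(n)}:(1-\psi_1^\chi(y^{(1)}))\cdots(1-\psi_n^\chi(y^{(n)}))>0\}$. Standing assumption: all the functions $R_k^N$ are well defined (the minima exist) and measurable (this is true, e.g., if the controls can take only finitely many values). $I_A$ denotes the indicator of $A$. *)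

theory Defs
  imports "HOL-Probability.Probability"
begin

text \<open>
  A vector \<open>z\<^sup>(\<^sup>n\<^sup>) = (z\<^sub>1, \<dots>, z\<^sub>n)\<close> is an element of the library product space over the index set
  \<open>{1..n}\<close>. A sequence of functions \<open>F\<^sub>n(x\<^sup>(\<^sup>n\<^sup>), y\<^sup>(\<^sup>n\<^sup>))\<close> has type
  \<open>nat \<Rightarrow> (nat \<Rightarrow> 'x) \<Rightarrow> (nat \<Rightarrow> 'y) \<Rightarrow> _\<close>. Of the measure \<open>X\<close> on controls only the underlying
  measurable space is used.
\<close>

abbreviation power_measure :: "'a measure \<Rightarrow> nat \<Rightarrow> (nat \<Rightarrow> 'a) measure" where
  "power_measure M n \<equiv> PiM {1..n} (\<lambda>_. M)"

abbreviation history_space ::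
    "'x measure \<Rightarrow> 'y measure \<Rightarrow> nat \<Rightarrow> ((nat \<Rightarrow> 'x) \<times> (nat \<Rightarrow> 'y)) measure" where
  "history_space X M n \<equiv> power_measure X n \<Otimes>\<^sub>M power_measure M n"

definition conditional_density ::
    "'x measure \<Rightarrow> 'y measure \<Rightarrow> ('x \<Rightarrow> 'y \<Rightarrow> real) \<Rightarrow> bool" where
  "conditional_density X M f \<longleftrightarrow>
     (\<lambda>(x, y). f x y) \<in> borel_measurable (X \<Otimes>\<^sub>M M) \<and>
     (\<forall>x\<in>space X. (\<forall>y\<in>space M. 0 \<le> f x y) \<and> prob_space (density M (\<lambda>y. ennreal (f x y))))"

definition joint_density ::
    "('x \<Rightarrow> 'y \<Rightarrow> real) \<Rightarrow> nat \<Rightarrow> (nat \<Rightarrow> 'x) \<Rightarrow> (nat \<Rightarrow> 'y) \<Rightarrow> real" where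
  "joint_density f n x y = (\<Prod>i=1..n. f (x i) (y i))"

text \<open>
  For \<open>n = 1\<close> the space \<open>history_space X M 0\<close> has exactly one point, so \<open>pol\<^sub>1\<close> is a constant.
\<close>

definition control_policy ::
    "'x measure \<Rightarrow> 'y measure \<Rightarrow> (nat \<Rightarrow> (nat \<Rightarrow> 'x) \<Rightarrow> (nat \<Rightarrow> 'y) \<Rightarrow> 'x) \<Rightarrow> bool" where
  "control_policy X M pol \<longleftrightarrow>
     (\<forall>n\<ge>1. (\<lambda>(x, y). pol n x y) \<in> history_space X M (n - 1) \<rightarrow>\<^sub>M X)"

definition stopping_rule ::
    "'x measure \<Rightarrow> 'y measure \<Rightarrow> (nat \<Rightarrow> (nat \<Rightarrow> 'x) \<Rightarrow> (nat \<Rightarrow> 'y) \<Rightarrow> real) \<Rightarrow> bool" where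
  "stopping_rule X M \<psi> \<longleftrightarrow>
     (\<forall>n\<ge>1. (\<lambda>(x, y). \<psi> n x y) \<in> borel_measurable (history_space X M n) \<and>
            (\<forall>(x, y)\<in>space (history_space X M n). 0 \<le> \<psi> n x y \<and> \<psi> n x y \<le> 1))"

definition truncated_stopping_rule ::
    "'x measure \<Rightarrow> 'y measure \<Rightarrow> nat \<Rightarrow> (nat \<Rightarrow> (nat \<Rightarrow> 'x) \<Rightarrow> (nat \<Rightarrow> 'y) \<Rightarrow> real) \<Rightarrow> bool" where
  "truncated_stopping_rule X M N \<psi> \<longleftrightarrow>
     stopping_rule X M \<psi> \<and> (\<forall>(x, y)\<in>space (history_space X M N). \<psi> N x y = 1)"

text \<open>
  \<open>controls pol n y\<close> is the vector of controls generated by \<open>x\<^sub>i = pol\<^sub>i(x\<^sub>1, \<dots>, x\<^sub>i\<^sub>-\<^sub>1; y\<^sub>1, \<dots>, y\<^sub>i\<^sub>-\<^sub>1)\<close>, and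
  \<open>along pol F n y\<close> is \<open>F\<^sub>n\<close> evaluated at these controls and \<open>y\<^sub>1, \<dots>, y\<^sub>n\<close>. Both restrict \<open>y\<close> to the
  coordinates they depend on, so they may be applied to response vectors longer than necessary.
\<close>

primrec controls ::
    "(nat \<Rightarrow> (nat \<Rightarrow> 'x) \<Rightarrow> (nat \<Rightarrow> 'y) \<Rightarrow> 'x) \<Rightarrow> nat \<Rightarrow> (nat \<Rightarrow> 'y) \<Rightarrow> nat \<Rightarrow> 'x" where
  "controls pol 0 y = (\<lambda>_. undefined)"
| "controls pol (Suc n) y =
     (controls pol n y)(Suc n := pol (Suc n) (controls pol n y) (restrict y {1..n}))"

definition along ::
    "(nat \<Rightarrow> (nat \<Rightarrow> 'x) \<Rightarrow> (nat \<Rightarrow> 'y) \<Rightarrow> 'x) \<Rightarrow>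
     (nat \<Rightarrow> (nat \<Rightarrow> 'x) \<Rightarrow> (nat \<Rightarrow> 'y) \<Rightarrow> 'b) \<Rightarrow> nat \<Rightarrow> (nat \<Rightarrow> 'y) \<Rightarrow> 'b" where
  "along pol F n y = F n (controls pol n y) (restrict y {1..n})"

definition not_stopped_before ::
    "(nat \<Rightarrow> (nat \<Rightarrow> 'x) \<Rightarrow> (nat \<Rightarrow> 'y) \<Rightarrow> real) \<Rightarrow>
     (nat \<Rightarrow> (nat \<Rightarrow> 'x) \<Rightarrow> (nat \<Rightarrow> 'y) \<Rightarrow> 'x) \<Rightarrow> nat \<Rightarrow> (nat \<Rightarrow> 'y) \<Rightarrow> real" where
  "not_stopped_before \<psi> pol n y = (\<Prod>i\<in>{1..<n}. 1 - along pol \<psi> i y)"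

definition stopped_at ::
    "(nat \<Rightarrow> (nat \<Rightarrow> 'x) \<Rightarrow> (nat \<Rightarrow> 'y) \<Rightarrow> real) \<Rightarrow>
     (nat \<Rightarrow> (nat \<Rightarrow> 'x) \<Rightarrow> (nat \<Rightarrow> 'y) \<Rightarrow> 'x) \<Rightarrow> nat \<Rightarrow> (nat \<Rightarrow> 'y) \<Rightarrow> real" where
  "stopped_at \<psi> pol n y = (\<Prod>i\<in>{1..<n}. 1 - along pol \<psi> i y) * along pol \<psi> n y"

definition reach_set ::
    "'y measure \<Rightarrow> (nat \<Rightarrow> (nat \<Rightarrow> 'x) \<Rightarrow> (nat \<Rightarrow> 'y) \<Rightarrow> real) \<Rightarrow>
     (nat \<Rightarrow> (nat \<Rightarrow> 'x) \<Rightarrow> (nat \<Rightarrow> 'y) \<Rightarrow> 'x) \<Rightarrow> nat \<Rightarrow> (nat \<Rightarrow> 'y) set" where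
  "reach_set M \<psi> pol n =
     {y \<in> space (power_measure M n). 0 < (\<Prod>i\<in>{1..<n}. 1 - along pol \<psi> i y)}"

definition continue_set ::
    "'y measure \<Rightarrow> (nat \<Rightarrow> (nat \<Rightarrow> 'x) \<Rightarrow> (nat \<Rightarrow> 'y) \<Rightarrow> real) \<Rightarrow>
     (nat \<Rightarrow> (nat \<Rightarrow> 'x) \<Rightarrow> (nat \<Rightarrow> 'y) \<Rightarrow> 'x) \<Rightarrow> nat \<Rightarrow> (nat \<Rightarrow> 'y) set" where
  "continue_set M \<psi> pol n =
     {y \<in> space (power_measure M n). 0 < (\<Prod>i\<in>{1..n}. 1 - along pol \<psi> i y)}"

definition stopping_loss ::
    "('x \<Rightarrow> 'y \<Rightarrow> real) \<Rightarrow> ('x \<Rightarrow> 'y \<Rightarrow> real) \<Rightarrow> real \<Rightarrow> real \<Rightarrow>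
     nat \<Rightarrow> (nat \<Rightarrow> 'x) \<Rightarrow> (nat \<Rightarrow> 'y) \<Rightarrow> real" where
  "stopping_loss f0 f1 lam0 lam1 n x y =
     min (lam0 * joint_density f0 n x y) (lam1 * joint_density f1 n x y)"

definition stage_risk ::
    "'y measure \<Rightarrow> ('x \<Rightarrow> 'y \<Rightarrow> real) \<Rightarrow> ('x \<Rightarrow> 'y \<Rightarrow> real) \<Rightarrow> real \<Rightarrow> real \<Rightarrow>
     (nat \<Rightarrow> (nat \<Rightarrow> 'x) \<Rightarrow> (nat \<Rightarrow> 'y) \<Rightarrow> 'x) \<Rightarrow>
     (nat \<Rightarrow> (nat \<Rightarrow> 'x) \<Rightarrow> (nat \<Rightarrow> 'y) \<Rightarrow> real) \<Rightarrow> nat \<Rightarrow> real" where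
  "stage_risk M f0 f1 lam0 lam1 pol \<psi> n =
     (\<integral>y. stopped_at \<psi> pol n y *
           (real n * along pol (joint_density f0) n y
            + along pol (stopping_loss f0 f1 lam0 lam1) n y) \<partial>power_measure M n)"

text \<open>
  The integrands are dominated by multiples of densities, and for a rule truncated at \<open>N\<close> the terms
  of the series with \<open>n > N\<close> vanish, so real-valued integrals and sums carry no default values.
\<close>

definition lagrangian_risk ::
    "'y measure \<Rightarrow> ('x \<Rightarrow> 'y \<Rightarrow> real) \<Rightarrow> ('x \<Rightarrow> 'y \<Rightarrow> real) \<Rightarrow> real \<Rightarrow> real \<Rightarrow>
     (nat \<Rightarrow> (nat \<Rightarrow> 'x) \<Rightarrow> (nat \<Rightarrow> 'y) \<Rightarrow> 'x) \<Rightarrow>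
     (nat \<Rightarrow> (nat \<Rightarrow> 'x) \<Rightarrow> (nat \<Rightarrow> 'y) \<Rightarrow> real) \<Rightarrow> real" where
  "lagrangian_risk M f0 f1 lam0 lam1 pol \<psi> = (\<Sum>n. stage_risk M f0 f1 lam0 lam1 pol \<psi> (Suc n))"

text \<open>
  \<open>next_integral M k F x y u\<close> is \<open>\<integral> F(x\<^sub>1, \<dots>, x\<^sub>k, u; y\<^sub>1, \<dots>, y\<^sub>k, z) d\<mu>(z)\<close>.
\<close>

definition next_integral ::
    "'y measure \<Rightarrow> nat \<Rightarrow> ((nat \<Rightarrow> 'x) \<Rightarrow> (nat \<Rightarrow> 'y) \<Rightarrow> real) \<Rightarrow>
     (nat \<Rightarrow> 'x) \<Rightarrow> (nat \<Rightarrow> 'y) \<Rightarrow> 'x \<Rightarrow> real" where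
  "next_integral M k F x y u = (\<integral>z. F (x(Suc k := u)) (y(Suc k := z)) \<partial>M)"

text \<open>
  \<open>min_integral\<close> is the minimum over the control space; existence of the minimizing control is the
  separate hypothesis \<open>minima_exist\<close> below.
\<close>

definition min_integral ::
    "'x measure \<Rightarrow> 'y measure \<Rightarrow> nat \<Rightarrow> ((nat \<Rightarrow> 'x) \<Rightarrow> (nat \<Rightarrow> 'y) \<Rightarrow> real) \<Rightarrow>
     (nat \<Rightarrow> 'x) \<Rightarrow> (nat \<Rightarrow> 'y) \<Rightarrow> real" where
  "min_integral X M k F x y = (INF u\<in>space X. next_integral M k F x y u)"

text \<open>
  \<open>Vfun X M f0 f1 lam0 lam1 N k\<close> is \<open>V\<^sub>k\<^sup>N\<close>, by recursion on \<open>N - k\<close>; it is meaningful for \<open>k \<le> N\<close>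
  only.
\<close>

function Vfun ::
    "'x measure \<Rightarrow> 'y measure \<Rightarrow> ('x \<Rightarrow> 'y \<Rightarrow> real) \<Rightarrow> ('x \<Rightarrow> 'y \<Rightarrow> real) \<Rightarrow> real \<Rightarrow> real \<Rightarrow>
     nat \<Rightarrow> nat \<Rightarrow> (nat \<Rightarrow> 'x) \<Rightarrow> (nat \<Rightarrow> 'y) \<Rightarrow> real" where
  "Vfun X M f0 f1 lam0 lam1 N k =
     (if N \<le> k then stopping_loss f0 f1 lam0 lam1 k
      else (\<lambda>x y. min (stopping_loss f0 f1 lam0 lam1 k x y)
                      (joint_density f0 k x y
                       + min_integral X M k (Vfun X M f0 f1 lam0 lam1 N (Suc k)) x y)))"
  by pat_completeness auto
termination
  by (relation "Wellfounded.measure (\<lambda>(X, M, f0, f1, lam0, lam1, N, k). N - k)") auto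

declare Vfun.simps [simp del]

definition Rfun ::
    "'x measure \<Rightarrow> 'y measure \<Rightarrow> ('x \<Rightarrow> 'y \<Rightarrow> real) \<Rightarrow> ('x \<Rightarrow> 'y \<Rightarrow> real) \<Rightarrow> real \<Rightarrow> real \<Rightarrow>
     nat \<Rightarrow> nat \<Rightarrow> (nat \<Rightarrow> 'x) \<Rightarrow> (nat \<Rightarrow> 'y) \<Rightarrow> real" where
  "Rfun X M f0 f1 lam0 lam1 N k = min_integral X M k (Vfun X M f0 f1 lam0 lam1 N (Suc k))"

lemma Vfun_last: "Vfun X M f0 f1 lam0 lam1 N N = stopping_loss f0 f1 lam0 lam1 N"
  by (simp add: Vfun.simps)

lemma Vfun_step:
  assumes "k < N"
  shows "Vfun X M f0 f1 lam0 lam1 N k x y =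
           min (stopping_loss f0 f1 lam0 lam1 k x y)
               (joint_density f0 k x y + Rfun X M f0 f1 lam0 lam1 N k x y)"
  using assms by (subst Vfun.simps) (simp add: Rfun_def)

definition minima_exist ::
    "'x measure \<Rightarrow> 'y measure \<Rightarrow> ('x \<Rightarrow> 'y \<Rightarrow> real) \<Rightarrow> ('x \<Rightarrow> 'y \<Rightarrow> real) \<Rightarrow> real \<Rightarrow> real \<Rightarrow>
     nat \<Rightarrow> nat \<Rightarrow> bool" where
  "minima_exist X M f0 f1 lam0 lam1 N k \<longleftrightarrow>
     (\<forall>(x, y)\<in>space (history_space X M k).
        \<exists>u. is_arg_min (next_integral M k (Vfun X M f0 f1 lam0 lam1 N (Suc k)) x y)
                       (\<lambda>u. u \<in> space X) u)"

end

theory Submission imports Defs begin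

text \<open>
  Write \<open>c\<^sub>k\<close> for the probability, given the responses, of not stopping before stage \<open>k\<close>, and let
  \<open>B\<^sub>k\<close> be the cost of stages \<open>1, \<dots>, k - 1\<close> plus \<open>\<integral> c\<^sub>k (k f\<^sub>0\<^sup>k + V\<^sub>k)\<close>. Since \<open>\<psi>\<^sub>N = 1\<close> and
  \<open>V\<^sub>N = l\<^sub>N\<close>, the risk \<open>L\<close> is \<open>B\<^sub>N\<close> (\<open>lower_bound_horizon\<close>), and the theorem compares
  \<open>B\<^sub>N\<close>, \<open>B\<^sub>r\<^sub>+\<^sub>1\<close> and \<open>B\<^sub>r\<close>.

  In \<open>B\<^sub>k\<^sub>+\<^sub>1\<close> the last response can be integrated out for a fixed control, because a conditional
  density integrates to one and controls use past responses only
  (\<open>integral_continuation_cost\<close>). With \<open>I\<^sub>k\<close> denoting the integral of \<open>V\<^sub>k\<^sub>+\<^sub>1\<close> over the last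
  response, this gives \<open>B\<^sub>k\<^sub>+\<^sub>1 - B\<^sub>k = \<integral> E\<^sub>k\<close> (\<open>lower_bound_Suc\<close>), where
  \<open>E\<^sub>k = c\<^sub>k (\<psi>\<^sub>k l\<^sub>k + (1 - \<psi>\<^sub>k) (f\<^sub>0\<^sup>k + R\<^sub>k) - min (l\<^sub>k) (f\<^sub>0\<^sup>k + R\<^sub>k)) + c\<^sub>k\<^sub>+\<^sub>1 (I\<^sub>k - R\<^sub>k)\<close>.
  The first summand is nonnegative because a weighted mean is at least the minimum, the second
  because \<open>R\<^sub>k\<close> minimizes over the controls. Hence \<open>B\<close> is nondecreasing, which yields both inequalities.

  Moreover \<open>L = B\<^sub>r\<close> holds exactly when every \<open>\<integral> E\<^sub>k\<close> with \<open>r \<le> k < N\<close> vanishes, i.e. when both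
  summands vanish almost everywhere. For the first this is the condition on \<open>\<psi>\<^sub>k\<close> where \<open>c\<^sub>k > 0\<close>,
  for the second the equation \<open>R\<^sub>k = I\<^sub>k\<close> where \<open>c\<^sub>k\<^sub>+\<^sub>1 > 0\<close>
  (\<open>integral_excess_eq_0_iff\<close>).
\<close>

section \<open>Histories generated by a control policy\<close>

lemma history_extend:
  assumes "(x, y) \<in> space (history_space X M k)" and "u \<in> space X" and "z \<in> space M"
  shows "(x(Suc k := u), y(Suc k := z)) \<in> space (history_space X M (Suc k))"
  using assms by (auto simp: space_pair_measure space_PiM PiE_iff extensional_def)

lemma atLeastAtMost_Suc_insert: "{1..Suc k} = insert (Suc k) {1..k}"
  by auto

locale controlled_experiment = sigma_finite_measure M
  for M :: "'y measure" +
  fixes X :: "'x measure" and pol :: "nat \<Rightarrow> (nat \<Rightarrow> 'x) \<Rightarrow> (nat \<Rightarrow> 'y) \<Rightarrow> 'x"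
  assumes policy: "control_policy X M pol"
begin

sublocale responses: product_sigma_finite "\<lambda>_::nat. M"
  unfolding product_sigma_finite_def using sigma_finite_measure_axioms by blast

lemma measurable_policy:
  "(\<lambda>(x, y). pol (Suc n) x y) \<in> history_space X M n \<rightarrow>\<^sub>M X"
  using policy unfolding control_policy_def by (metis Suc_eq_plus1 diff_Suc_1 le_add2)

lemma policy_in_space:
  "(x, y) \<in> space (history_space X M n) \<Longrightarrow> pol (Suc n) x y \<in> space X"
  using measurable_space[OF measurable_policy[of n]] by auto

lemma control_space_nonempty: "space X \<noteq> {}"
  using policy_in_space[of "\<lambda>_. undefined" "\<lambda>_. undefined" 0]
  by (auto simp: space_pair_measure space_PiM)

lemma measurable_restrict_responses:
  "n \<le> m \<Longrightarrow> (\<lambda>y. restrict y {1..n}) \<in> power_measure M m \<rightarrow>\<^sub>M power_measure M n"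
  by (rule measurable_restrict_subset) auto

lemma measurable_controls:
  "n \<le> m \<Longrightarrow> controls pol n \<in> power_measure M m \<rightarrow>\<^sub>M power_measure X n"
proof (induction n)
  case 0
  then show ?case by (simp add: PiM_empty)
next
  case (Suc n)
  have "(\<lambda>y. (controls pol n y, restrict y {1..n})) \<in> power_measure M m \<rightarrow>\<^sub>M history_space X M n"
    using Suc by (intro measurable_Pair measurable_restrict_responses) auto
  from measurable_compose[OF this measurable_policy]
  have "(\<lambda>y. pol (Suc n) (controls pol n y) (restrict y {1..n})) \<in> power_measure M m \<rightarrow>\<^sub>M X"
    by simp
  then show ?case
    using Suc unfolding controls.simps by (intro measurable_fun_upd[where J = "{1..n}"]) auto
qed

lemma measurable_history:
  "n \<le> m \<Longrightarrow>
    (\<lambda>y. (controls pol n y, restrict y {1..n})) \<in> power_measure M m \<rightarrow>\<^sub>M history_space X M n"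
  by (intro measurable_Pair measurable_controls measurable_restrict_responses) auto

lemma history_in_space:
  "n \<le> m \<Longrightarrow> y \<in> space (power_measure M m) \<Longrightarrow>
    (controls pol n y, restrict y {1..n}) \<in> space (history_space X M n)"
  using measurable_space[OF measurable_history] by auto

lemma measurable_along:
  assumes "(\<lambda>(x, y). F n x y) \<in> history_space X M n \<rightarrow>\<^sub>M L" and "n \<le> m"
  shows "along pol F n \<in> power_measure M m \<rightarrow>\<^sub>M L"
  using measurable_compose[OF measurable_history[OF assms(2)] assms(1)]
  by (simp add: along_def[abs_def])

text \<open>
  Controls use past responses only, so changing the response at stage \<open>k + 1\<close> leaves everything
  up to stage \<open>k\<close>, and the control at stage \<open>k + 1\<close>, as it was. This is what lets the last response be
  integrated out for a fixed control.
\<close>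

lemma controls_cong:
  "(\<And>i. i \<in> {1..<n} \<Longrightarrow> y i = y' i) \<Longrightarrow> controls pol n y = controls pol n y'"
proof (induction n)
  case (Suc n)
  have "restrict y {1..n} = restrict y' {1..n}"
    using Suc.prems by (auto simp: restrict_def fun_eq_iff)
  with Suc show ?case by simp
qed simp

lemma along_update_later: "n \<le> k \<Longrightarrow> along pol F n (y(Suc k := z)) = along pol F n y"
  unfolding along_def
  by (subst controls_cong[where y' = y]) (auto simp: restrict_def fun_eq_iff intro!: arg_cong[where f = "F n _"])

lemma along_update_last:
  assumes "y \<in> space (power_measure M k)"
  shows "along pol F (Suc k) (y(Suc k := z)) =
    F (Suc k) ((controls pol k y)(Suc k := pol (Suc k) (controls pol k y) y)) (y(Suc k := z))"
proof -
  have "restrict (y(Suc k := z)) {1..Suc k} = y(Suc k := z)" "restrict (y(Suc k := z)) {1..k} = y"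
    using assms by (auto simp: space_PiM PiE_iff extensional_def fun_eq_iff)
  moreover have "controls pol k (y(Suc k := z)) = controls pol k y"
    by (rule controls_cong) auto
  ultimately show ?thesis
    by (simp add: along_def)
qed

lemma along_eq:
  "y \<in> space (power_measure M k) \<Longrightarrow> along pol F k y = F k (controls pol k y) y"
  by (simp add: along_def space_PiM PiE_restrict)

lemma measurable_response_update:
  "(\<lambda>(y, z). y(Suc k := z)) \<in> power_measure M k \<Otimes>\<^sub>M M \<rightarrow>\<^sub>M power_measure M (Suc k)"
  unfolding atLeastAtMost_Suc_insert by (rule measurable_add_dim)

lemma integral_last_response:
  fixes g :: "(nat \<Rightarrow> 'y) \<Rightarrow> real"
  assumes "integrable (power_measure M (Suc k)) g"
  shows "(\<integral>y. g y \<partial>power_measure M (Suc k)) =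
    (\<integral>y. (\<integral>z. g (y(Suc k := z)) \<partial>M) \<partial>power_measure M k)"
  using assms unfolding atLeastAtMost_Suc_insert
  by (intro responses.product_integral_insert) auto

lemma measurable_integral_last_response:
  fixes g :: "(nat \<Rightarrow> 'y) \<Rightarrow> real"
  assumes "g \<in> borel_measurable (power_measure M (Suc k))"
  shows "(\<lambda>y. \<integral>z. g (y(Suc k := z)) \<partial>M) \<in> borel_measurable (power_measure M k)"
  using measurable_compose[OF measurable_response_update assms]
  by (intro borel_measurable_lebesgue_integral) (simp add: case_prod_beta')

end

section \<open>Joint densities\<close>

lemma conditional_densityD:
  assumes "conditional_density X M f" and "x \<in> space X"
  shows "y \<in> space M \<Longrightarrow> 0 \<le> f x y"
    and "integrable M (f x)" and "(\<integral>y. f x y \<partial>M) = 1"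
    and "(\<integral>\<^sup>+y. ennreal (f x y) \<partial>M) = 1"
proof -
  have meas: "f x \<in> borel_measurable M"
    using assms unfolding conditional_density_def
    by (auto dest: measurable_Pair2)
  have nonneg: "\<And>y. y \<in> space M \<Longrightarrow> 0 \<le> f x y"
    and "prob_space (density M (\<lambda>y. ennreal (f x y)))"
    using assms unfolding conditional_density_def by auto
  from prob_space.emeasure_space_1[OF this(2)]
  show nn: "(\<integral>\<^sup>+y. ennreal (f x y) \<partial>M) = 1"
    using meas by (simp add: emeasure_density cong: nn_integral_cong)
  show "y \<in> space M \<Longrightarrow> 0 \<le> f x y"
    by (rule nonneg)
  show "integrable M (f x)"
    using nn nonneg meas by (intro integrableI_nn_integral_finite[where x = 1]) auto
  show "(\<integral>y. f x y \<partial>M) = 1"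
    using nn nonneg meas by (subst integral_eq_nn_integral) auto
qed

lemma measurable_joint_density:
  assumes "conditional_density X M f"
  shows "(\<lambda>(x, y). joint_density f n x y) \<in> borel_measurable (history_space X M n)"
proof -
  have f: "(\<lambda>(x, y). f x y) \<in> borel_measurable (X \<Otimes>\<^sub>M M)"
    using assms by (simp add: conditional_density_def)
  have "(\<lambda>p. f (fst p i) (snd p i)) \<in> borel_measurable (history_space X M n)" if "i \<in> {1..n}" for i
  proof -
    have "(\<lambda>p. (fst p i, snd p i)) \<in> history_space X M n \<rightarrow>\<^sub>M X \<Otimes>\<^sub>M M"
      using that by measurable
    from measurable_compose[OF this f] show ?thesis by simp
  qed
  then show ?thesis
    unfolding joint_density_def case_prod_beta' by (intro borel_measurable_prod)
qed

lemma joint_density_nonneg: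
  assumes "conditional_density X M f" and "(x, y) \<in> space (history_space X M n)"
  shows "0 \<le> joint_density f n x y"
  unfolding joint_density_def
  using assms by (intro prod_nonneg) (auto simp: space_pair_measure space_PiM PiE_iff
      intro!: conditional_densityD(1)[OF assms(1)])

lemma joint_density_extend:
  "joint_density f (Suc k) (x(Suc k := u)) (y(Suc k := z)) = joint_density f k x y * f u z"
  unfolding joint_density_def by (simp add: prod.nat_ivl_Suc')

context controlled_experiment
begin

lemma along_joint_density_extend:
  "y \<in> space (power_measure M k) \<Longrightarrow>
    along pol (joint_density f) (Suc k) (y(Suc k := z)) =
      along pol (joint_density f) k y * f (pol (Suc k) (controls pol k y) y) z"
  by (simp add: along_update_last joint_density_extend along_eq)

lemma along_joint_density_nonneg:
  assumes "conditional_density X M f" and "y \<in> space (power_measure M n)"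
  shows "0 \<le> along pol (joint_density f) n y"
  unfolding along_def
  by (rule joint_density_nonneg[OF assms(1) history_in_space[OF order_refl assms(2)]])

lemma next_control_in_space:
  "y \<in> space (power_measure M k) \<Longrightarrow> pol (Suc k) (controls pol k y) y \<in> space X"
  using history_in_space[of k k y] by (intro policy_in_space) (auto simp: space_PiM PiE_restrict)

text \<open>
  Each stage multiplies the joint density by a conditional density of the next response, which
  integrates to one whatever control the policy has chosen.
\<close>

lemma nn_integral_joint_density:
  assumes f: "conditional_density X M f"
  shows "(\<integral>\<^sup>+y. ennreal (along pol (joint_density f) n y) \<partial>power_measure M n) = 1"
proof (induction n)
  case 0
  show ?case by (simp add: along_def joint_density_def PiM_empty)
next
  case (Suc k)
  have meas: "along pol (joint_density f) (Suc k) \<in> borel_measurable (power_measure M (Suc k))"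
    by (intro measurable_along measurable_joint_density[OF f]) auto
  then have "(\<integral>\<^sup>+y. ennreal (along pol (joint_density f) (Suc k) y) \<partial>power_measure M (Suc k)) =
      (\<integral>\<^sup>+y. (\<integral>\<^sup>+z. ennreal (along pol (joint_density f) (Suc k) (y(Suc k := z))) \<partial>M)
        \<partial>power_measure M k)"
    unfolding atLeastAtMost_Suc_insert by (subst responses.product_nn_integral_insert) auto
  also have "\<dots> = (\<integral>\<^sup>+y. ennreal (along pol (joint_density f) k y) \<partial>power_measure M k)"
  proof (rule nn_integral_cong)
    fix y assume y: "y \<in> space (power_measure M k)"
    let ?u = "pol (Suc k) (controls pol k y) y"
    have u: "?u \<in> space X" by (rule next_control_in_space[OF y])
    have "(\<integral>\<^sup>+z. ennreal (along pol (joint_density f) (Suc k) (y(Suc k := z))) \<partial>M) =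
        (\<integral>\<^sup>+z. ennreal (along pol (joint_density f) k y) * ennreal (f ?u z) \<partial>M)"
      by (intro nn_integral_cong)
        (simp add: along_joint_density_extend[OF y] ennreal_mult
          along_joint_density_nonneg[OF f y] conditional_densityD(1)[OF f u])
    then show "(\<integral>\<^sup>+z. ennreal (along pol (joint_density f) (Suc k) (y(Suc k := z))) \<partial>M) =
        ennreal (along pol (joint_density f) k y)"
      using conditional_densityD(2,4)[OF f u] by (simp add: nn_integral_cmult)
  qed
  finally show ?case using Suc.IH by simp
qed

lemma integrable_joint_density:
  assumes "conditional_density X M f"
  shows "integrable (power_measure M n) (along pol (joint_density f) n)"
  using nn_integral_joint_density[OF assms, of n] measurable_joint_density[OF assms]
    along_joint_density_nonneg[OF assms]
  by (intro integrableI_nn_integral_finite[where x = 1] measurable_along) auto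

end

section \<open>A randomized choice between two options\<close>

lemma randomized_choice_excess_nonneg:
  fixes p a b :: real
  assumes "0 \<le> p" and "p \<le> 1"
  shows "0 \<le> p * a + (1 - p) * b - min a b"
proof -
  have "p * min a b + (1 - p) * min a b \<le> p * a + (1 - p) * b"
    using assms by (intro add_mono mult_left_mono) auto
  then show ?thesis by (simp add: algebra_simps)
qed

text \<open>
  If the two options cost the same, every randomization between them is optimal; this is why the
  lower bound for \<open>p\<close> uses the strict and the upper bound the weak inequality.
\<close>

lemma randomized_choice_excess_eq_0_iff:
  fixes p a b :: real
  assumes "0 \<le> p" and "p \<le> 1"
  shows "p * a + (1 - p) * b - min a b = 0 \<longleftrightarrow>
    (if a < b then 1 else 0) \<le> p \<and> p \<le> (if a \<le> b then 1 else 0)"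
proof -
  have "p * a + (1 - p) * b - min a b = (if a \<le> b then (1 - p) * (b - a) else p * (a - b))"
    by (simp add: algebra_simps)
  then show ?thesis using assms by auto
qed

section \<open>The dynamic programming functions\<close>

locale truncated_test = controlled_experiment M X pol
  for M :: "'y measure" and X :: "'x measure" and pol +
  fixes f0 f1 :: "'x \<Rightarrow> 'y \<Rightarrow> real" and lam0 lam1 :: real
    and \<psi> :: "nat \<Rightarrow> (nat \<Rightarrow> 'x) \<Rightarrow> (nat \<Rightarrow> 'y) \<Rightarrow> real" and N :: nat
  assumes f0: "conditional_density X M f0" and f1: "conditional_density X M f1"
    and lam0: "0 \<le> lam0" and lam1: "0 \<le> lam1"
    and measurable_R: "\<And>k. k \<in> {1..N - 1} \<Longrightarrow>
      (\<lambda>(x, y). Rfun X M f0 f1 lam0 lam1 N k x y) \<in> borel_measurable (history_space X M k)"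
    and rule: "truncated_stopping_rule X M N \<psi>"
    and N: "1 \<le> N"
begin

abbreviation "loss \<equiv> stopping_loss f0 f1 lam0 lam1"
abbreviation "V \<equiv> Vfun X M f0 f1 lam0 lam1 N"
abbreviation "R \<equiv> Rfun X M f0 f1 lam0 lam1 N"

lemma loss_bounds:
  assumes "(x, y) \<in> space (history_space X M n)"
  shows "0 \<le> loss n x y" and "loss n x y \<le> lam0 * joint_density f0 n x y"
  using joint_density_nonneg[OF f0 assms] joint_density_nonneg[OF f1 assms] lam0 lam1
  by (auto simp: stopping_loss_def)

lemma measurable_loss: "(\<lambda>(x, y). loss n x y) \<in> borel_measurable (history_space X M n)"
  using measurable_joint_density[OF f0, of n] measurable_joint_density[OF f1, of n]
  unfolding stopping_loss_def case_prod_beta' by measurable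

lemma V_le_loss: "k \<le> N \<Longrightarrow> V k x y \<le> loss k x y"
  by (cases "k = N") (simp_all add: Vfun_last Vfun_step)

lemma measurable_V:
  assumes "k \<in> {1..N}"
  shows "(\<lambda>(x, y). V k x y) \<in> borel_measurable (history_space X M k)"
proof (cases "k = N")
  case True
  then show ?thesis using measurable_loss[of N] by (simp add: Vfun_last)
next
  case False
  with assms have "k < N" "k \<in> {1..N - 1}" by auto
  then show ?thesis
    using measurable_loss[of k] measurable_joint_density[OF f0, of k] measurable_R[of k]
    unfolding case_prod_beta' by (simp add: Vfun_step)
qed

text \<open>
  The real-valued infimum defining \<open>R\<^sub>k\<close> is a lower bound of its values only because these are
  bounded below; nonnegativity of \<open>V\<^sub>k\<^sub>+\<^sub>1\<close> supplies the bound.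
\<close>

lemma V_nonneg:
  "k \<le> N \<Longrightarrow> (x, y) \<in> space (history_space X M k) \<Longrightarrow> 0 \<le> V k x y"
proof (induction k arbitrary: x y rule: inc_induct)
  case base
  then show ?case using loss_bounds by (simp add: Vfun_last)
next
  case (step k)
  have "0 \<le> R k x y"
    unfolding Rfun_def min_integral_def next_integral_def
    using step.prems
    by (intro cINF_greatest control_space_nonempty Bochner_Integration.integral_nonneg step.IH
        history_extend) auto
  then show ?case
    using step loss_bounds(1)[OF step.prems] joint_density_nonneg[OF f0 step.prems]
    by (simp add: Vfun_step)
qed

lemma R_le_next_integral:
  assumes "k < N" and "(x, y) \<in> space (history_space X M k)" and "u \<in> space X"
  shows "R k x y \<le> next_integral M k (V (Suc k)) x y u"
  unfolding Rfun_def min_integral_def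
proof (rule cINF_lower)
  show "bdd_below (next_integral M k (V (Suc k)) x y ` space X)"
    unfolding next_integral_def using assms(1,2)
    by (intro bdd_belowI2[where m = 0] Bochner_Integration.integral_nonneg V_nonneg history_extend)
      auto
qed (rule assms(3))

section \<open>Costs along the policy\<close>

abbreviation "dens \<equiv> along pol (joint_density f0)"
abbreviation "loss_pol \<equiv> along pol loss"
abbreviation "V_pol \<equiv> along pol V"
abbreviation "R_pol \<equiv> along pol R"
abbreviation "stop \<equiv> along pol \<psi>"
abbreviation "reach \<equiv> not_stopped_before \<psi> pol"

text \<open>
  The counterpart of \<open>R\<^sub>k\<close> in which the next control is the one prescribed by the policy instead of
  a minimizing one.
\<close>

definition V_next :: "nat \<Rightarrow> (nat \<Rightarrow> 'y) \<Rightarrow> real" where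
  "V_next k y = (\<integral>z. V_pol (Suc k) (y(Suc k := z)) \<partial>M)"

lemma dens_nonneg: "y \<in> space (power_measure M n) \<Longrightarrow> 0 \<le> dens n y"
  by (rule along_joint_density_nonneg[OF f0])

lemma loss_pol_bounds:
  assumes "y \<in> space (power_measure M n)"
  shows "0 \<le> loss_pol n y" and "loss_pol n y \<le> lam0 * dens n y"
  using loss_bounds[OF history_in_space[OF order_refl assms]] by (simp_all add: along_def)

lemma V_pol_bounds:
  assumes "n \<le> N" and "y \<in> space (power_measure M n)"
  shows "0 \<le> V_pol n y" and "V_pol n y \<le> loss_pol n y"
  using V_nonneg[OF assms(1) history_in_space[OF order_refl assms(2)]] V_le_loss[OF assms(1)]
  by (simp_all add: along_def)

lemma V_pol_step: "k < N \<Longrightarrow> V_pol k y = min (loss_pol k y) (dens k y + R_pol k y)"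
  by (simp add: along_def Vfun_step)

lemma stop_bounds:
  assumes "n \<in> {1..m}" and "y \<in> space (power_measure M m)"
  shows "0 \<le> stop n y" and "stop n y \<le> 1"
proof -
  have "stopping_rule X M \<psi>" using rule by (simp add: truncated_stopping_rule_def)
  moreover have "(controls pol n y, restrict y {1..n}) \<in> space (history_space X M n)"
    using assms by (intro history_in_space) auto
  ultimately show "0 \<le> stop n y" "stop n y \<le> 1"
    using assms(1) by (force simp: stopping_rule_def along_def)+
qed

lemma stop_at_horizon:
  assumes "N \<le> m" and "y \<in> space (power_measure M m)"
  shows "stop N y = 1"
  using rule history_in_space[OF assms]
  by (auto simp: truncated_stopping_rule_def along_def)

lemma measurable_stop: "n \<in> {1..m} \<Longrightarrow> stop n \<in> borel_measurable (power_measure M m)"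
  using rule by (intro measurable_along) (auto simp: truncated_stopping_rule_def stopping_rule_def)

lemma reach_bounds:
  assumes "n \<le> Suc m" and "y \<in> space (power_measure M m)"
  shows "0 \<le> reach n y" and "reach n y \<le> 1"
  unfolding not_stopped_before_def
  using stop_bounds[OF _ assms(2)] assms(1)
  by (auto intro!: prod_nonneg prod_le_1)

lemma measurable_reach:
  "n \<le> Suc m \<Longrightarrow> reach n \<in> borel_measurable (power_measure M m)"
  unfolding not_stopped_before_def[abs_def]
  by (intro borel_measurable_prod borel_measurable_diff borel_measurable_const measurable_stop) auto

lemma reach_Suc: "1 \<le> n \<Longrightarrow> reach (Suc n) y = reach n y * (1 - stop n y)"
  unfolding not_stopped_before_def by (simp add: prod.atLeastLessThan_Suc)

lemma stopped_at_eq: "stopped_at \<psi> pol n y = reach n y * stop n y"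
  by (simp add: stopped_at_def not_stopped_before_def)

lemma reach_update_later: "reach (Suc k) (y(Suc k := z)) = reach (Suc k) y"
  unfolding not_stopped_before_def by (intro prod.cong) (auto simp: along_update_later)

lemma measurable_dens: "dens n \<in> borel_measurable (power_measure M n)"
  by (intro measurable_along measurable_joint_density[OF f0]) simp

lemma measurable_loss_pol: "loss_pol n \<in> borel_measurable (power_measure M n)"
  by (intro measurable_along measurable_loss) simp

lemma measurable_V_pol: "n \<in> {1..N} \<Longrightarrow> V_pol n \<in> borel_measurable (power_measure M n)"
  by (intro measurable_along measurable_V) auto

text \<open>
  All costs satisfy \<open>0 \<le> V\<^sub>n \<le> l\<^sub>n \<le> \<lambda>\<^sub>0 f\<^sub>0\<^sup>n\<close> and all weights are probabilities, so a multiple of the joint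
  density under \<open>f0\<close> dominates every integrand below.
\<close>

lemma integrable_dominated_by_dens:
  assumes "g \<in> borel_measurable (power_measure M n)"
    and "\<And>y. y \<in> space (power_measure M n) \<Longrightarrow> \<bar>g y\<bar> \<le> b * dens n y"
  shows "integrable (power_measure M n) g"
  using assms(1)
proof (rule Bochner_Integration.integrable_bound[rotated])
  show "integrable (power_measure M n) (\<lambda>y. b * dens n y)"
    using integrable_joint_density[OF f0] by simp
  show "AE y in power_measure M n. norm (g y) \<le> norm (b * dens n y)"
    using assms(2) by (intro AE_I2) (force simp: abs_le_iff)
qed

lemma integrable_weighted:
  assumes w: "w \<in> borel_measurable (power_measure M n)"
    and w01: "\<And>y. y \<in> space (power_measure M n) \<Longrightarrow> 0 \<le> w y \<and> w y \<le> 1"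
    and g: "g \<in> borel_measurable (power_measure M n)"
    and gb: "\<And>y. y \<in> space (power_measure M n) \<Longrightarrow> 0 \<le> g y \<and> g y \<le> b * dens n y"
  shows "integrable (power_measure M n) (\<lambda>y. w y * g y)"
proof (rule integrable_dominated_by_dens[where b = b])
  show "(\<lambda>y. w y * g y) \<in> borel_measurable (power_measure M n)"
    using w g by simp
  fix y assume y: "y \<in> space (power_measure M n)"
  have "w y * g y \<le> 1 * g y" using w01[OF y] gb[OF y] by (intro mult_right_mono) auto
  then show "\<bar>w y * g y\<bar> \<le> b * dens n y" using w01[OF y] gb[OF y] by auto
qed

text \<open>
  Along the policy the control at stage \<open>k + 1\<close> is one particular competitor in the minimum that
  defines \<open>R\<^sub>k\<close>, so the cost it leads to cannot be smaller than \<open>R\<^sub>k\<close>.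
\<close>

lemma V_next_integrable_and_bounds:
  assumes k: "k < N" and y: "y \<in> space (power_measure M k)"
  shows "integrable M (\<lambda>z. V_pol (Suc k) (y(Suc k := z)))"
    and "0 \<le> V_next k y" and "V_next k y \<le> lam0 * dens k y" and "R_pol k y \<le> V_next k y"
proof -
  let ?u = "pol (Suc k) (controls pol k y) y"
  have u: "?u \<in> space X" by (rule next_control_in_space[OF y])
  have upd: "y(Suc k := z) \<in> space (power_measure M (Suc k))" if "z \<in> space M" for z
    using measurable_space[OF measurable_response_update[of k], of "(y, z)"] y that
    by (auto simp: space_pair_measure)
  have bounds: "0 \<le> V_pol (Suc k) (y(Suc k := z))"
    "V_pol (Suc k) (y(Suc k := z)) \<le> lam0 * (dens k y * f0 ?u z)" if "z \<in> space M" for z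
    using V_pol_bounds[OF Suc_leI[OF k] upd[OF that]] loss_pol_bounds[OF upd[OF that]]
    by (auto simp: along_joint_density_extend[OF y])
  have int_bound: "integrable M (\<lambda>z. lam0 * (dens k y * f0 ?u z))"
    using conditional_densityD(2)[OF f0 u] by simp
  have "(\<lambda>z. y(Suc k := z)) \<in> M \<rightarrow>\<^sub>M power_measure M (Suc k)"
    using measurable_Pair2[OF measurable_response_update y] by simp
  from measurable_compose[OF this measurable_V_pol]
  have "(\<lambda>z. V_pol (Suc k) (y(Suc k := z))) \<in> borel_measurable M"
    using k by simp
  with int_bound show int: "integrable M (\<lambda>z. V_pol (Suc k) (y(Suc k := z)))"
    by (rule Bochner_Integration.integrable_bound) (intro AE_I2, use bounds in force)
  show "0 \<le> V_next k y"
    unfolding V_next_def using bounds by (intro Bochner_Integration.integral_nonneg) auto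
  have "V_next k y \<le> (\<integral>z. lam0 * (dens k y * f0 ?u z) \<partial>M)"
    unfolding V_next_def using int int_bound bounds by (intro integral_mono) auto
  then show "V_next k y \<le> lam0 * dens k y"
    using conditional_densityD(3)[OF f0 u] by simp
  have "(controls pol k y, y) \<in> space (history_space X M k)"
    using history_in_space[OF order_refl y] y by (simp add: space_PiM PiE_restrict)
  from R_le_next_integral[OF k this u] show "R_pol k y \<le> V_next k y"
    by (simp add: V_next_def next_integral_def along_update_last[OF y] along_eq[OF y])
qed

section \<open>The loss incurred by one suboptimal stage\<close>

text \<open>
  The cost of the first \<open>k - 1\<close> stages under the given policy and rule, plus the cost that
  backward induction assigns to everything from stage \<open>k\<close> on.
\<close>

definition lower_bound :: "nat \<Rightarrow> real" where
  "lower_bound k = (\<Sum>n=1..k - 1. stage_risk M f0 f1 lam0 lam1 pol \<psi> n)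
     + (\<integral>y. reach k y * (real k * dens k y + V_pol k y) \<partial>power_measure M k)"

text \<open>
  The first term is the loss from a stopping decision at stage \<open>k\<close> that does not achieve the minimum
  defining \<open>V\<^sub>k\<close>, the second the loss from continuing with a control that does not achieve the
  minimum defining \<open>R\<^sub>k\<close>.
\<close>

definition excess :: "nat \<Rightarrow> (nat \<Rightarrow> 'y) \<Rightarrow> real" where
  "excess k y =
     reach k y * (stop k y * loss_pol k y + (1 - stop k y) * (dens k y + R_pol k y) - V_pol k y)
     + reach (Suc k) y * (V_next k y - R_pol k y)"

lemma excess_nonneg_and_eq_0_iff:
  assumes k: "k \<in> {1..<N}" and y: "y \<in> space (power_measure M k)"
  shows "0 \<le> excess k y"
    and "excess k y = 0 \<longleftrightarrow>
      (0 < reach k y \<longrightarrow> (if loss_pol k y < dens k y + R_pol k y then 1 else 0) \<le> stop k y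
        \<and> stop k y \<le> (if loss_pol k y \<le> dens k y + R_pol k y then 1 else 0))
      \<and> (0 < reach (Suc k) y \<longrightarrow> R_pol k y = V_next k y)"
proof -
  have k': "k < N" using k by simp
  have p: "0 \<le> stop k y" "stop k y \<le> 1" using stop_bounds[of k k] k y by auto
  let ?s = "stop k y * loss_pol k y + (1 - stop k y) * (dens k y + R_pol k y) - V_pol k y"
  have s0: "0 \<le> ?s"
    using randomized_choice_excess_nonneg[OF p] by (simp add: V_pol_step[OF k'])
  have siff: "?s = 0 \<longleftrightarrow> (if loss_pol k y < dens k y + R_pol k y then 1 else 0) \<le> stop k y
        \<and> stop k y \<le> (if loss_pol k y \<le> dens k y + R_pol k y then 1 else 0)"
    unfolding V_pol_step[OF k'] by (rule randomized_choice_excess_eq_0_iff[OF p])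
  have c: "0 \<le> reach k y" "0 \<le> reach (Suc k) y"
    using reach_bounds(1)[of _ k y] y by auto
  have R: "0 \<le> V_next k y - R_pol k y"
    using V_next_integrable_and_bounds(4)[OF k' y] by simp
  have nonneg: "0 \<le> reach k y * ?s" "0 \<le> reach (Suc k) y * (V_next k y - R_pol k y)"
    using s0 c R by simp_all
  then show "0 \<le> excess k y"
    unfolding excess_def by simp
  have "excess k y = 0 \<longleftrightarrow> reach k y * ?s = 0 \<and> reach (Suc k) y * (V_next k y - R_pol k y) = 0"
    unfolding excess_def using nonneg by (rule add_nonneg_eq_0_iff)
  also have "\<dots> \<longleftrightarrow> (0 < reach k y \<longrightarrow> ?s = 0) \<and> (0 < reach (Suc k) y \<longrightarrow> R_pol k y = V_next k y)"
    using c by auto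
  finally show "excess k y = 0 \<longleftrightarrow>
      (0 < reach k y \<longrightarrow> (if loss_pol k y < dens k y + R_pol k y then 1 else 0) \<le> stop k y
        \<and> stop k y \<le> (if loss_pol k y \<le> dens k y + R_pol k y then 1 else 0))
      \<and> (0 < reach (Suc k) y \<longrightarrow> R_pol k y = V_next k y)"
    unfolding siff .
qed

lemma integrable_stage_cost:
  assumes n: "1 \<le> n"
  shows "integrable (power_measure M n)
    (\<lambda>y. stopped_at \<psi> pol n y * (real n * dens n y + loss_pol n y))"
  unfolding stopped_at_eq
proof (rule integrable_weighted[where b = "real n + lam0"])
  show "(\<lambda>y. reach n y * stop n y) \<in> borel_measurable (power_measure M n)"
    using n by (intro borel_measurable_times measurable_reach measurable_stop) auto
  show "(\<lambda>y. real n * dens n y + loss_pol n y) \<in> borel_measurable (power_measure M n)"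
    using measurable_dens measurable_loss_pol by simp
  fix y assume y: "y \<in> space (power_measure M n)"
  show "0 \<le> reach n y * stop n y \<and> reach n y * stop n y \<le> 1"
    using reach_bounds[of n n y] stop_bounds[of n n y] n y by (auto intro: mult_le_one)
  show "0 \<le> real n * dens n y + loss_pol n y
      \<and> real n * dens n y + loss_pol n y \<le> (real n + lam0) * dens n y"
    using dens_nonneg[OF y] loss_pol_bounds[OF y] by (simp add: distrib_right)
qed

lemma integrable_continuation_cost:
  assumes n: "n \<in> {1..N}"
  shows "integrable (power_measure M n) (\<lambda>y. reach n y * (real n * dens n y + V_pol n y))"
proof (rule integrable_weighted[where b = "real n + lam0"])
  show "reach n \<in> borel_measurable (power_measure M n)"
    by (rule measurable_reach) simp
  show "(\<lambda>y. real n * dens n y + V_pol n y) \<in> borel_measurable (power_measure M n)"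
    using measurable_dens measurable_V_pol[OF n] by simp
  fix y assume y: "y \<in> space (power_measure M n)"
  show "0 \<le> reach n y \<and> reach n y \<le> 1"
    using reach_bounds[of n n y] y by simp
  show "0 \<le> real n * dens n y + V_pol n y
      \<and> real n * dens n y + V_pol n y \<le> (real n + lam0) * dens n y"
    using dens_nonneg[OF y] loss_pol_bounds[OF y] V_pol_bounds[OF _ y] n
    by (simp add: distrib_right)
qed

lemma integrable_reach_V_next:
  assumes k: "k \<in> {1..<N}"
  shows "integrable (power_measure M k)
    (\<lambda>y. reach (Suc k) y * (real (Suc k) * dens k y + V_next k y))"
proof (rule integrable_weighted[where b = "real (Suc k) + lam0"])
  have "V_next k \<in> borel_measurable (power_measure M k)"
    unfolding V_next_def[abs_def]
    using k by (intro measurable_integral_last_response measurable_V_pol) auto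
  with measurable_dens
  show "(\<lambda>y. real (Suc k) * dens k y + V_next k y) \<in> borel_measurable (power_measure M k)"
    by measurable
  show "0 \<le> real (Suc k) * dens k y + V_next k y
      \<and> real (Suc k) * dens k y + V_next k y \<le> (real (Suc k) + lam0) * dens k y"
    if y: "y \<in> space (power_measure M k)" for y
    using V_next_integrable_and_bounds(2,3)[OF _ y] k dens_nonneg[OF y] by (auto simp: algebra_simps)
qed (use measurable_reach[of "Suc k" k] reach_bounds[of "Suc k" k] in auto)

text \<open>
  Neither the decision to continue after stage \<open>k\<close> nor the control at stage \<open>k + 1\<close> depends on
  \<open>y\<^sub>k\<^sub>+\<^sub>1\<close>, so integrating this response out turns the density of stage \<open>k + 1\<close> into that of
  stage \<open>k\<close> and \<open>V\<^sub>k\<^sub>+\<^sub>1\<close> into \<open>V_next\<close>.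
\<close>

lemma integral_continuation_cost:
  assumes k: "k \<in> {1..<N}"
  shows "(\<integral>y. reach (Suc k) y * (real (Suc k) * dens (Suc k) y + V_pol (Suc k) y)
      \<partial>power_measure M (Suc k)) =
    (\<integral>y. reach (Suc k) y * (real (Suc k) * dens k y + V_next k y) \<partial>power_measure M k)"
proof (subst integral_last_response)
  show "integrable (power_measure M (Suc k))
      (\<lambda>y. reach (Suc k) y * (real (Suc k) * dens (Suc k) y + V_pol (Suc k) y))"
    using k by (intro integrable_continuation_cost) auto
  show "(\<integral>y. (\<integral>z. reach (Suc k) (y(Suc k := z)) * (real (Suc k) * dens (Suc k) (y(Suc k := z))
        + V_pol (Suc k) (y(Suc k := z))) \<partial>M) \<partial>power_measure M k) =
    (\<integral>y. reach (Suc k) y * (real (Suc k) * dens k y + V_next k y) \<partial>power_measure M k)"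
  proof (rule Bochner_Integration.integral_cong[OF refl])
    fix y assume y: "y \<in> space (power_measure M k)"
    let ?u = "pol (Suc k) (controls pol k y) y"
    have u: "?u \<in> space X" by (rule next_control_in_space[OF y])
    have "integrable M (\<lambda>z. V_pol (Suc k) (y(Suc k := z)))"
      using V_next_integrable_and_bounds(1)[OF _ y] k by simp
    then show "(\<integral>z. reach (Suc k) (y(Suc k := z)) * (real (Suc k) * dens (Suc k) (y(Suc k := z))
        + V_pol (Suc k) (y(Suc k := z))) \<partial>M) =
      reach (Suc k) y * (real (Suc k) * dens k y + V_next k y)"
      using conditional_densityD(2,3)[OF f0 u]
      by (simp add: reach_update_later along_joint_density_extend[OF y] V_next_def
          del: of_nat_Suc)
  qed
qed

text \<open>
  Two cancellations make the defining expression of \<open>excess\<close> telescope. The weight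
  \<open>1 - \<psi>\<^sub>k\<close> of continuing is common to both terms, so \<open>R\<^sub>k\<close> drops out; and the observation costs
  \<open>\<psi>\<^sub>k k + (1 - \<psi>\<^sub>k) (k + 1) - k\<close> leave exactly the cost \<open>1 - \<psi>\<^sub>k\<close> of one further observation.
\<close>

lemma excess_eq:
  assumes "1 \<le> k"
  shows "excess k y = stopped_at \<psi> pol k y * (real k * dens k y + loss_pol k y)
    + reach (Suc k) y * (real (Suc k) * dens k y + V_next k y)
    - reach k y * (real k * dens k y + V_pol k y)"
  unfolding excess_def stopped_at_eq reach_Suc[OF assms] by (simp add: algebra_simps)

lemma integrable_excess:
  assumes k: "k \<in> {1..<N}"
  shows "integrable (power_measure M k) (excess k)"
proof -
  have "1 \<le> k" and "k \<in> {1..N}" using k by auto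
  then show ?thesis
    unfolding excess_eq[OF \<open>1 \<le> k\<close>, abs_def]
    by (intro Bochner_Integration.integrable_diff Bochner_Integration.integrable_add
        integrable_stage_cost integrable_continuation_cost integrable_reach_V_next[OF k])
qed

lemma lower_bound_Suc:
  assumes k: "k \<in> {1..<N}"
  shows "lower_bound (Suc k) = lower_bound k + (\<integral>y. excess k y \<partial>power_measure M k)"
proof -
  have "1 \<le> k" and k': "k \<in> {1..N}" using k by auto
  have "(\<integral>y. excess k y \<partial>power_measure M k) = stage_risk M f0 f1 lam0 lam1 pol \<psi> k
      + (\<integral>y. reach (Suc k) y * (real (Suc k) * dens (Suc k) y + V_pol (Suc k) y)
          \<partial>power_measure M (Suc k))
      - (\<integral>y. reach k y * (real k * dens k y + V_pol k y) \<partial>power_measure M k)"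
    unfolding excess_eq[OF \<open>1 \<le> k\<close>] stage_risk_def integral_continuation_cost[OF k]
    using integrable_stage_cost[OF \<open>1 \<le> k\<close>] integrable_continuation_cost[OF k']
      integrable_reach_V_next[OF k]
    by (simp del: of_nat_Suc)
  moreover have "(\<Sum>n=1..k. stage_risk M f0 f1 lam0 lam1 pol \<psi> n) =
      (\<Sum>n=1..k - 1. stage_risk M f0 f1 lam0 lam1 pol \<psi> n) + stage_risk M f0 f1 lam0 lam1 pol \<psi> k"
    using \<open>1 \<le> k\<close> by (cases k) auto
  ultimately show ?thesis
    by (simp add: lower_bound_def)
qed

text \<open>
  Truncation makes stopping at stage \<open>N\<close> certain, so there the bound is the risk itself.
\<close>

lemma lower_bound_horizon: "lower_bound N = lagrangian_risk M f0 f1 lam0 lam1 pol \<psi>"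
proof -
  have zero: "stage_risk M f0 f1 lam0 lam1 pol \<psi> n = 0" if "N < n" for n
  proof -
    have "stopped_at \<psi> pol n y = 0" if y: "y \<in> space (power_measure M n)" for y
    proof -
      have "N \<in> {1..<n}" "1 - stop N y = 0"
        using N \<open>N < n\<close> stop_at_horizon[of n y] y by auto
      then show ?thesis
        unfolding stopped_at_def by (metis finite_atLeastLessThan mult_zero_left prod_zero)
    qed
    then show ?thesis
      unfolding stage_risk_def by (simp cong: Bochner_Integration.integral_cong)
  qed
  have "lagrangian_risk M f0 f1 lam0 lam1 pol \<psi> =
      (\<Sum>n<N. stage_risk M f0 f1 lam0 lam1 pol \<psi> (Suc n))"
    unfolding lagrangian_risk_def by (rule suminf_finite) (auto intro!: zero)
  also have "\<dots> = (\<Sum>n=1..N. stage_risk M f0 f1 lam0 lam1 pol \<psi> n)"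
    by (rule sum.reindex_bij_witness[where i = "\<lambda>n. n - 1" and j = Suc]) auto
  also have "\<dots> = (\<Sum>n=1..N - 1. stage_risk M f0 f1 lam0 lam1 pol \<psi> n)
      + stage_risk M f0 f1 lam0 lam1 pol \<psi> N"
    using N by (cases N) auto
  also have "stage_risk M f0 f1 lam0 lam1 pol \<psi> N =
      (\<integral>y. reach N y * (real N * dens N y + V_pol N y) \<partial>power_measure M N)"
    unfolding stage_risk_def
    by (intro Bochner_Integration.integral_cong refl)
      (simp add: stopped_at_eq stop_at_horizon[OF order_refl] along_def[of _ V] along_def[of _ loss]
        Vfun_last)
  finally show ?thesis by (simp add: lower_bound_def)
qed

lemma integral_excess_nonneg:
  "k \<in> {1..<N} \<Longrightarrow> 0 \<le> (\<integral>y. excess k y \<partial>power_measure M k)"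
  by (intro Bochner_Integration.integral_nonneg excess_nonneg_and_eq_0_iff(1))

lemma risk_eq_lower_bound_plus_excess:
  assumes "1 \<le> r" and "r \<le> N"
  shows "lagrangian_risk M f0 f1 lam0 lam1 pol \<psi> =
    lower_bound r + (\<Sum>k\<in>{r..<N}. \<integral>y. excess k y \<partial>power_measure M k)"
proof -
  have "lower_bound m = lower_bound r + (\<Sum>k\<in>{r..<m}. \<integral>y. excess k y \<partial>power_measure M k)"
    if "r \<le> m" "m \<le> N" for m
    using that
  proof (induction m rule: dec_induct)
    case (step m)
    then show ?case using assms lower_bound_Suc[of m] by simp
  qed simp
  from this[OF assms(2) order_refl] show ?thesis by (simp add: lower_bound_horizon)
qed

lemma integral_excess_eq_0_iff:
  assumes k: "k \<in> {1..<N}"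
  shows "(\<integral>y. excess k y \<partial>power_measure M k) = 0 \<longleftrightarrow>
    (AE y in power_measure M k. y \<in> reach_set M \<psi> pol k \<longrightarrow>
       indicat_real {y. loss_pol k y < dens k y + R_pol k y} y \<le> stop k y \<and>
       stop k y \<le> indicat_real {y. loss_pol k y \<le> dens k y + R_pol k y} y) \<and>
    (AE y in power_measure M k. y \<in> continue_set M \<psi> pol k \<longrightarrow>
       R_pol k y = (\<integral>z. V_pol (k + 1) (y(k + 1 := z)) \<partial>M))"
proof -
  have "(\<integral>y. excess k y \<partial>power_measure M k) = 0 \<longleftrightarrow> (AE y in power_measure M k. excess k y = 0)"
    using excess_nonneg_and_eq_0_iff(1)[OF k]
    by (intro integral_nonneg_eq_0_iff_AE integrable_excess[OF k] AE_I2)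
  also have "\<dots> \<longleftrightarrow> (AE y in power_measure M k.
      (y \<in> reach_set M \<psi> pol k \<longrightarrow>
        indicat_real {y. loss_pol k y < dens k y + R_pol k y} y \<le> stop k y \<and>
        stop k y \<le> indicat_real {y. loss_pol k y \<le> dens k y + R_pol k y} y) \<and>
      (y \<in> continue_set M \<psi> pol k \<longrightarrow>
        R_pol k y = (\<integral>z. V_pol (k + 1) (y(k + 1 := z)) \<partial>M)))"
    by (rule AE_cong) (simp add: excess_nonneg_and_eq_0_iff(2)[OF k] reach_set_def continue_set_def
        not_stopped_before_def V_next_def indicator_def atLeastLessThanSuc_atLeastAtMost)
  finally show ?thesis by simp
qed

end

section \<open>The lower bounds and their attainment\<close>

theorem theorem4p2:
  fixes X :: "'x measure" and M :: "'y measure"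
    and f0 f1 :: "'x \<Rightarrow> 'y \<Rightarrow> real"
    and lam0 lam1 :: real
    and pol :: "nat \<Rightarrow> (nat \<Rightarrow> 'x) \<Rightarrow> (nat \<Rightarrow> 'y) \<Rightarrow> 'x"
    and \<psi> :: "nat \<Rightarrow> (nat \<Rightarrow> 'x) \<Rightarrow> (nat \<Rightarrow> 'y) \<Rightarrow> real"
    and N r :: nat
  assumes "sigma_finite_measure M"
    and "conditional_density X M f0" and "conditional_density X M f1"
    and "0 \<le> lam0" and "0 \<le> lam1"
    and "\<And>k. k \<in> {1..N - 1} \<Longrightarrow> minima_exist X M f0 f1 lam0 lam1 N k"
    and "\<And>k. k \<in> {1..N - 1} \<Longrightarrow>
           (\<lambda>(x, y). Rfun X M f0 f1 lam0 lam1 N k x y) \<in> borel_measurable (history_space X M k)"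
    and "truncated_stopping_rule X M N \<psi>"
    and "control_policy X M pol"
    and "1 \<le> r" and "r \<le> N - 1"
  shows
    "lagrangian_risk M f0 f1 lam0 lam1 pol \<psi>
       \<ge> (\<Sum>n=1..r. stage_risk M f0 f1 lam0 lam1 pol \<psi> n)
         + (\<integral>y. not_stopped_before \<psi> pol (r + 1) y *
                 (real (r + 1) * along pol (joint_density f0) (r + 1) y
                  + along pol (Vfun X M f0 f1 lam0 lam1 N) (r + 1) y) \<partial>power_measure M (r + 1))
     \<and>
     (\<Sum>n=1..r. stage_risk M f0 f1 lam0 lam1 pol \<psi> n)
         + (\<integral>y. not_stopped_before \<psi> pol (r + 1) y *
                 (real (r + 1) * along pol (joint_density f0) (r + 1) y
                  + along pol (Vfun X M f0 f1 lam0 lam1 N) (r + 1) y) \<partial>power_measure M (r + 1))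
       \<ge> (\<Sum>n=1..r - 1. stage_risk M f0 f1 lam0 lam1 pol \<psi> n)
         + (\<integral>y. not_stopped_before \<psi> pol r y *
                 (real r * along pol (joint_density f0) r y
                  + along pol (Vfun X M f0 f1 lam0 lam1 N) r y) \<partial>power_measure M r)
     \<and>
     (lagrangian_risk M f0 f1 lam0 lam1 pol \<psi>
       = (\<Sum>n=1..r - 1. stage_risk M f0 f1 lam0 lam1 pol \<psi> n)
         + (\<integral>y. not_stopped_before \<psi> pol r y *
                 (real r * along pol (joint_density f0) r y
                  + along pol (Vfun X M f0 f1 lam0 lam1 N) r y) \<partial>power_measure M r)
      \<longleftrightarrow>
      (\<forall>k\<in>{r..N - 1}.
         (AE y in power_measure M k. y \<in> reach_set M \<psi> pol k \<longrightarrow>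
            indicat_real {y. along pol (stopping_loss f0 f1 lam0 lam1) k y
                             < along pol (joint_density f0) k y
                               + along pol (Rfun X M f0 f1 lam0 lam1 N) k y} y
              \<le> along pol \<psi> k y \<and>
            along pol \<psi> k y
              \<le> indicat_real {y. along pol (stopping_loss f0 f1 lam0 lam1) k y
                                 \<le> along pol (joint_density f0) k y
                                   + along pol (Rfun X M f0 f1 lam0 lam1 N) k y} y) \<and>
         (AE y in power_measure M k. y \<in> continue_set M \<psi> pol k \<longrightarrow>
            along pol (Rfun X M f0 f1 lam0 lam1 N) k y
              = (\<integral>z. along pol (Vfun X M f0 f1 lam0 lam1 N) (k + 1) (y(k + 1 := z)) \<partial>M))))"
proof -
  interpret sigma_finite_measure M by fact
  interpret truncated_test M X pol f0 f1 lam0 lam1 \<psi> N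
    using assms by unfold_locales auto
  have r: "1 \<le> r" "r \<le> N" "r \<in> {1..<N}" and range: "{r..N - 1} = {r..<N}"
    using assms by auto
  let ?E = "\<lambda>k. \<integral>y. excess k y \<partial>power_measure M k"
  have E_nonneg: "0 \<le> ?E k" if "k \<in> {r..<N}" for k
    using that r by (intro integral_excess_nonneg) auto
  have "0 \<le> (\<Sum>k\<in>{Suc r..<N}. ?E k)"
    by (intro sum_nonneg E_nonneg) auto
  then have first: "lower_bound (Suc r) \<le> lagrangian_risk M f0 f1 lam0 lam1 pol \<psi>"
    using risk_eq_lower_bound_plus_excess[of "Suc r"] r by simp
  have second: "lower_bound r \<le> lower_bound (Suc r)"
    using lower_bound_Suc[OF r(3)] integral_excess_nonneg[OF r(3)] by simp
  have "lagrangian_risk M f0 f1 lam0 lam1 pol \<psi> = lower_bound r \<longleftrightarrow> (\<Sum>k\<in>{r..<N}. ?E k) = 0"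
    using risk_eq_lower_bound_plus_excess[OF r(1,2)] by simp
  also have "\<dots> \<longleftrightarrow> (\<forall>k\<in>{r..<N}. ?E k = 0)"
    using E_nonneg by (intro sum_nonneg_eq_0_iff) auto
  finally have attained: "lagrangian_risk M f0 f1 lam0 lam1 pol \<psi> = lower_bound r \<longleftrightarrow>
      (\<forall>k\<in>{r..N - 1}. ?E k = 0)"
    unfolding range .
  have E_iff: "(\<forall>k\<in>{r..N - 1}. ?E k = 0) \<longleftrightarrow> (\<forall>k\<in>{r..N - 1}.
    (AE y in power_measure M k. y \<in> reach_set M \<psi> pol k \<longrightarrow>
       indicat_real {y. loss_pol k y < dens k y + R_pol k y} y \<le> stop k y \<and>
       stop k y \<le> indicat_real {y. loss_pol k y \<le> dens k y + R_pol k y} y) \<and>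
    (AE y in power_measure M k. y \<in> continue_set M \<psi> pol k \<longrightarrow>
       R_pol k y = (\<integral>z. V_pol (k + 1) (y(k + 1 := z)) \<partial>M)))"
    using r(1) by (intro ball_cong refl integral_excess_eq_0_iff) auto
  show ?thesis
    using first second attained[unfolded E_iff]
    unfolding lower_bound_def Suc_eq_plus1 add_diff_cancel_right' by blast
qed

end
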